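(* Let $\mathbb{K}$ be a field of characteristic different from $2$, let $\delta\in\mathbb{K}^\times$, and let $a,b\in\mathfrak{sl}_2(\mathbb{K})$ satisfy $\det(a)=\det(b)=-\delta\neq 0$ and $\operatorname{bir}(a,b)\notin\{1,\infty\}$. Then the matrices $M\in\mathrm{PGL}_2(\mathbb{K})$ conjugating $a$ to $b$ (that is, $MaM^{-1}=b$) have a well defined determinant in the quotient group $\mathbb{K}^\times/\mathrm{N}_{\mathbb{K}}(\mathbb{K}[\sqrt{\delta}]^\times)$, and it is equal to the class of $\operatorname{bir}(a,b)$.
   Context: $\mathfrak{sl}_2(\mathbb{K})$ is the space of trace-zero $2\times 2$ matrices over $\mathbb{K}$, with the symmetric bilinear form $\langle a,b\rangle=-\tfrac12\operatorname{Tr}(ab)$ (so $\langle a,a\rangle=\det(a)$). For $a,b\in\mathfrak{sl}_2(\mathbb{K})$ with the same determinant $d\neq0$, put $\cos(a,b)=\langle a,b\rangle/d$. The cross-ratio $\operatorname{bir}(a,b)\in\mathbb{K}\cup\{\infty\}$ is given by $\frac{1}{\operatorname{bir}(a,b)}=\frac{1+\cos(a,b)}{2}$, i.e. $\operatorname{bir}(a,b)=\frac{2d}{d+\langle a,b\rangle}$ (equal to $\infty$ if $\langle a,b\rangle=-d$). Equivalently, it is the cross-ratio $\frac{(\alpha-\alpha')(\beta-\beta')}{(\alpha-\beta')(\beta-\alpha')}$ of the pairs of fixed points $(\alpha',\alpha)$ of $a$ and $(\beta',\beta)$ of $b$ on the projective line over $\mathbb{K}[\sqrt{-d}]$, ordered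 consistently by the choice of one square root $\sqrt{-d}$ (eigenvalues $-\sqrt{-d}$, $+\sqrt{-d}$). $\mathbb{K}[\sqrt\delta]=\mathbb{K}[X]/(X^2-\delta)$, with norm $\mathrm{N}_{\mathbb{K}}(x+y\sqrt\delta)=x^2-\delta y^2$; $\mathrm{N}_{\mathbb{K}}(\mathbb{K}[\sqrt\delta]^\times)$ is the group of norms of invertible elements. An element of $\mathrm{PGL}_2(\mathbb{K})$ has a determinant defined modulo $(\mathbb{K}^\times)^2\subset \mathrm{N}_{\mathbb{K}}(\mathbb{K}[\sqrt\delta]^\times)$. *)

theory Defs
  imports "HOL-Analysis.Analysis" "HOL-Algebra.Algebraic_Closure_Type"
begin

no_notation fps_nth (infixl "$" 75)

section \<open>Trace-zero matrices and the cross-ratio\<close>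

definition sl2 :: "('a::field ^ 2 ^ 2) set" where
  "sl2 = {a. trace a = 0}"

definition sl2_form :: "'a::field ^ 2 ^ 2 \<Rightarrow> 'a ^ 2 ^ 2 \<Rightarrow> 'a" where
  "sl2_form a b = - (1 / 2) * trace (a ** b)"

lemma sl2_form_self:
  assumes "(2 :: 'a::field) \<noteq> 0" and "a \<in> sl2"
  shows "sl2_form a a = det (a :: 'a ^ 2 ^ 2)"
proof -
  have t: "a $ 2 $ 2 = - a $ 1 $ 1"
    using assms(2) by (simp add: sl2_def trace_def sum_2 eq_neg_iff_add_eq_0 add.commute)
  have "2 * sl2_form a a = 2 * det a"
    using assms(1)
    by (simp add: sl2_form_def trace_def matrix_matrix_mult_def sum_2 det_2 t algebra_simps)
  then show ?thesis using assms(1) by simp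
qed

text \<open>Only meaningful if \<^term>\<open>det a = det b\<close> is nonzero.\<close>

definition sl2_cos :: "'a::field ^ 2 ^ 2 \<Rightarrow> 'a ^ 2 ^ 2 \<Rightarrow> 'a" where
  "sl2_cos a b = sl2_form a b / det a"

datatype 'a with_infinity = Finite 'a | Infinity

definition bir :: "'a::field ^ 2 ^ 2 \<Rightarrow> 'a ^ 2 ^ 2 \<Rightarrow> 'a with_infinity" where
  "bir a b = (let c = (1 + sl2_cos a b) / 2 in if c = 0 then Infinity else Finite (1 / c))"

lemma bir_altdef:
  assumes "(2 :: 'a::field) \<noteq> 0" and "det (a :: 'a ^ 2 ^ 2) = d" and "d \<noteq> 0"
  shows "bir a b = (if sl2_form a b = - d then Infinity
           else Finite (2 * d / (d + sl2_form a b)))"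
proof -
  have eq: "(1 + sl2_cos a b) / 2 = (d + sl2_form a b) / (2 * d)"
    using assms by (simp add: sl2_cos_def field_simps)
  have "(d + sl2_form a b = 0) = (sl2_form a b = - d)"
    by (metis add.commute eq_neg_iff_add_eq_0)
  then show ?thesis
    using assms by (simp add: bir_def Let_def eq)
qed


section \<open>The algebra $K[\sqrt{\delta}]$ and its norm group\<close>

definition quad_ideal :: "'a::field \<Rightarrow> 'a poly set" where
  "quad_ideal \<delta> = PIdl\<^bsub>ring_of_type_algebra\<^esub> [:- \<delta>, 0, 1:]"

definition quad_ext :: "'a::field \<Rightarrow> 'a poly set ring" where
  "quad_ext \<delta> = ring_of_type_algebra Quot quad_ideal \<delta>"

text \<open>The element \<open>x + y \<surd>\<delta>\<close>.\<close>

definition quad_elem :: "'a::field \<Rightarrow> 'a \<Rightarrow> 'a \<Rightarrow> 'a poly set" where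
  "quad_elem \<delta> x y = quad_ideal \<delta> +>\<^bsub>ring_of_type_algebra\<^esub> [:x, y:]"

definition quad_norm :: "'a::field \<Rightarrow> 'a poly set \<Rightarrow> 'a" where
  "quad_norm \<delta> z = (THE n. \<exists>x y. z = quad_elem \<delta> x y \<and> n = x\<^sup>2 - \<delta> * y\<^sup>2)"

definition norm_group :: "'a::field \<Rightarrow> 'a set" where
  "norm_group \<delta> = quad_norm \<delta> ` Units (quad_ext \<delta>)"

definition mult_group_of_field :: "'a::field monoid" where
  "mult_group_of_field = units_of ring_of_type_algebra"

definition norm_quotient :: "'a::field \<Rightarrow> 'a set monoid" where
  "norm_quotient \<delta> = mult_group_of_field Mod norm_group \<delta>"

definition norm_residue :: "'a::field \<Rightarrow> 'a \<Rightarrow> 'a set" where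
  "norm_residue \<delta> t = norm_group \<delta> #>\<^bsub>mult_group_of_field\<^esub> t"

lemma rta_simps:
  "carrier ring_of_type_algebra = (UNIV :: 'r::comm_ring_1 set)"
  "mult ring_of_type_algebra = ((*) :: 'r \<Rightarrow> _)"
  "one ring_of_type_algebra = (1 :: 'r)"
  "zero ring_of_type_algebra = (0 :: 'r)"
  "add ring_of_type_algebra = ((+) :: 'r \<Rightarrow> _)"
  by (simp_all add: ring_of_type_algebra_def fun_eq_iff)

lemma quad_ideal_eq: "quad_ideal \<delta> = {p. [:- \<delta>, 0, 1:] dvd p}"
  by (auto simp: quad_ideal_def cgenideal_def rta_simps dvd_def mult.commute)

lemma quad_ideal_ideal: "ideal (quad_ideal \<delta>) ring_of_type_algebra"
  unfolding quad_ideal_def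
  by (rule cring.cgenideal_ideal[OF cring_from_type_algebra]) (simp add: rta_simps)

lemma quad_coset_eq: "quad_ideal \<delta> +>\<^bsub>ring_of_type_algebra\<^esub> p = {q. [:- \<delta>, 0, 1:] dvd q - p}"
proof (intro Set.set_eqI iffI)
  fix q assume "q \<in> quad_ideal \<delta> +>\<^bsub>ring_of_type_algebra\<^esub> p"
  then show "q \<in> {q. [:- \<delta>, 0, 1:] dvd q - p}"
    by (auto simp: a_r_coset_def' quad_ideal_eq rta_simps)
next
  fix q assume "q \<in> {q. [:- \<delta>, 0, 1:] dvd q - p}"
  then show "q \<in> quad_ideal \<delta> +>\<^bsub>ring_of_type_algebra\<^esub> p"
    by (auto simp: a_r_coset_def' quad_ideal_eq rta_simps intro!: exI[of _ "q - p"])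
qed

lemma quad_coset_eq_iff:
  "quad_ideal \<delta> +>\<^bsub>ring_of_type_algebra\<^esub> p = quad_ideal \<delta> +>\<^bsub>ring_of_type_algebra\<^esub> q
     \<longleftrightarrow> [:- \<delta>, 0, 1:] dvd p - q"
proof
  assume "quad_ideal \<delta> +>\<^bsub>ring_of_type_algebra\<^esub> p = quad_ideal \<delta> +>\<^bsub>ring_of_type_algebra\<^esub> q"
  then have "p \<in> {r. [:- \<delta>, 0, 1:] dvd r - q}"
    unfolding quad_coset_eq by auto
  then show "[:- \<delta>, 0, 1:] dvd p - q" by simp
next
  assume d: "[:- \<delta>, 0, 1:] dvd p - q"
  have "[:- \<delta>, 0, 1:] dvd r - p \<longleftrightarrow> [:- \<delta>, 0, 1:] dvd r - q" for r
    using dvd_add_left_iff[OF d, of "r - p"] by (simp add: algebra_simps)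
  then show "quad_ideal \<delta> +>\<^bsub>ring_of_type_algebra\<^esub> p = quad_ideal \<delta> +>\<^bsub>ring_of_type_algebra\<^esub> q"
    unfolding quad_coset_eq by simp
qed

lemma quad_elem_eq_iff: "quad_elem \<delta> x y = quad_elem \<delta> u v \<longleftrightarrow> x = u \<and> y = v"
proof
  assume "quad_elem \<delta> x y = quad_elem \<delta> u v"
  then have d: "[:- \<delta>, 0, 1:] dvd [:x - u, y - v:]"
    by (simp add: quad_elem_def quad_coset_eq_iff)
  have "[:x - u, y - v:] = 0"
  proof (rule ccontr)
    assume "[:x - u, y - v:] \<noteq> 0"
    from dvd_imp_degree_le[OF d this] show False
      by (simp split: if_splits)
  qed
  then show "x = u \<and> y = v" by simp
qed simp

lemma quad_norm_elem: "quad_norm \<delta> (quad_elem \<delta> x y) = x\<^sup>2 - \<delta> * y\<^sup>2"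
  unfolding quad_norm_def by (rule the_equality) (auto simp: quad_elem_eq_iff)

lemma quad_coset_is_elem: "\<exists>x y. quad_ideal \<delta> +>\<^bsub>ring_of_type_algebra\<^esub> p = quad_elem \<delta> x y"
proof -
  define r where "r = p mod [:- \<delta>, 0, 1:]"
  have "r = 0 \<or> Polynomial.degree r < 2"
    using degree_mod_less[of "[:- \<delta>, 0, 1:]" p] by (auto simp: r_def)
  then have "r = [:Polynomial.coeff r 0, Polynomial.coeff r 1:]"
    by (intro poly_eqI) (auto simp: coeff_pCons coeff_eq_0 split: nat.split)
  moreover have "[:- \<delta>, 0, 1:] dvd p - r"
    unfolding r_def minus_mod_eq_div_mult by (rule dvd_triv_right)
  ultimately show ?thesis
    unfolding quad_elem_def quad_coset_eq_iff by metis
qed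

lemma carrier_quad_ext: "carrier (quad_ext \<delta>) = {quad_elem \<delta> x y | x y. True}"
  using quad_coset_is_elem
  by (fastforce simp: quad_ext_def FactRing_def A_RCOSETS_def' rta_simps quad_elem_def)

lemma quad_mult:
  "quad_elem \<delta> x y \<otimes>\<^bsub>quad_ext \<delta>\<^esub> quad_elem \<delta> u v
     = quad_elem \<delta> (x * u + \<delta> * y * v) (x * v + y * u)"
proof -
  have "quad_elem \<delta> x y \<otimes>\<^bsub>quad_ext \<delta>\<^esub> quad_elem \<delta> u v
      = quad_ideal \<delta> +>\<^bsub>ring_of_type_algebra\<^esub> ([:x, y:] * [:u, v:])"
    using ideal.rcoset_mult_add[OF quad_ideal_ideal, of "[:x, y:]" "[:u, v:]" \<delta>]
    by (simp add: quad_ext_def FactRing_def quad_elem_def rta_simps)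
  also have "\<dots> = quad_elem \<delta> (x * u + \<delta> * y * v) (x * v + y * u)"
    unfolding quad_elem_def quad_coset_eq_iff
    by (rule dvdI[of _ _ "[:y * v:]"]) (simp add: algebra_simps)
  finally show ?thesis .
qed

lemma quad_one: "\<one>\<^bsub>quad_ext \<delta>\<^esub> = quad_elem \<delta> 1 0"
  by (simp add: quad_ext_def FactRing_def quad_elem_def rta_simps one_pCons)

lemma quad_norm_mult:
  "(x * u + \<delta> * y * v)\<^sup>2 - \<delta> * (x * v + y * u)\<^sup>2
     = (x\<^sup>2 - \<delta> * y\<^sup>2) * (u\<^sup>2 - \<delta> * v\<^sup>2)" for \<delta> :: "'a::field"
  by (simp add: power2_eq_square algebra_simps)

lemma quad_unit_iff: "quad_elem \<delta> x y \<in> Units (quad_ext \<delta>) \<longleftrightarrow> x\<^sup>2 - \<delta> * y\<^sup>2 \<noteq> 0"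
proof
  assume "quad_elem \<delta> x y \<in> Units (quad_ext \<delta>)"
  then obtain u v where "quad_elem \<delta> x y \<otimes>\<^bsub>quad_ext \<delta>\<^esub> quad_elem \<delta> u v = \<one>\<^bsub>quad_ext \<delta>\<^esub>"
    by (auto simp: Units_def carrier_quad_ext)
  then have "x * u + \<delta> * y * v = 1" "x * v + y * u = 0"
    by (auto simp: quad_mult quad_one quad_elem_eq_iff)
  then have "(x\<^sup>2 - \<delta> * y\<^sup>2) * (u\<^sup>2 - \<delta> * v\<^sup>2) = 1"
    by (simp flip: quad_norm_mult)
  then show "x\<^sup>2 - \<delta> * y\<^sup>2 \<noteq> 0" by auto
next
  assume n: "x\<^sup>2 - \<delta> * y\<^sup>2 \<noteq> 0"
  define m where "m = x\<^sup>2 - \<delta> * y\<^sup>2"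
  have "x * (x / m) + \<delta> * y * (- y / m) = 1"
  proof -
    have "x * (x / m) + \<delta> * y * (- y / m) = (x\<^sup>2 - \<delta> * y\<^sup>2) / m"
      by (simp add: power2_eq_square diff_divide_distrib)
    then show ?thesis using n by (simp add: m_def)
  qed
  moreover have "x * (- y / m) + y * (x / m) = 0" by simp
  moreover have "x / m * x + \<delta> * (- y / m) * y = 1"
    using calculation(1) by (simp add: algebra_simps)
  moreover have "x / m * y + (- y / m) * x = 0" by simp
  ultimately have
    "quad_elem \<delta> x y \<otimes>\<^bsub>quad_ext \<delta>\<^esub> quad_elem \<delta> (x / m) (- y / m) = \<one>\<^bsub>quad_ext \<delta>\<^esub>"
    "quad_elem \<delta> (x / m) (- y / m) \<otimes>\<^bsub>quad_ext \<delta>\<^esub> quad_elem \<delta> x y = \<one>\<^bsub>quad_ext \<delta>\<^esub>"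
    by (simp_all only: quad_mult quad_one)
  then show "quad_elem \<delta> x y \<in> Units (quad_ext \<delta>)"
    unfolding Units_def carrier_quad_ext by blast
qed

lemma norm_group_eq: "norm_group \<delta> = {n. n \<noteq> 0 \<and> (\<exists>x y. n = x\<^sup>2 - \<delta> * y\<^sup>2)}"
proof -
  have "Units (quad_ext \<delta>) = {quad_elem \<delta> x y | x y. x\<^sup>2 - \<delta> * y\<^sup>2 \<noteq> 0}"
    using quad_unit_iff[of \<delta>] unfolding Units_def carrier_quad_ext by blast
  then show ?thesis
    unfolding norm_group_def by (force simp: quad_norm_elem image_def)
qed

lemma mult_group_simps:
  "carrier mult_group_of_field = - {0 :: 'a::field}"
  "mult mult_group_of_field = ((*) :: 'a \<Rightarrow> _)"
  "one mult_group_of_field = (1 :: 'a)"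
proof -
  have "x \<noteq> 0 \<Longrightarrow> \<exists>y. y * x = 1 \<and> x * y = 1" for x :: 'a
    by (rule exI[of _ "inverse x"]) simp
  then show "carrier mult_group_of_field = - {0 :: 'a}"
    by (auto simp: mult_group_of_field_def units_of_def Units_def rta_simps)
qed (simp_all add: mult_group_of_field_def units_of_def rta_simps)

lemma comm_group_mult_group: "comm_group (mult_group_of_field :: 'a::field monoid)"
proof -
  interpret cring "ring_of_type_algebra :: 'a ring" ..
  show ?thesis unfolding mult_group_of_field_def by (rule units_comm_group)
qed

lemma norm_group_normal: "norm_group \<delta> \<lhd> mult_group_of_field"
proof -
  interpret comm_group "mult_group_of_field :: 'a monoid"
    by (rule comm_group_mult_group)
  have "subgroup (norm_group \<delta>) mult_group_of_field"
  proof (rule subgroupI)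
    show "norm_group \<delta> \<subseteq> carrier mult_group_of_field"
      by (auto simp: norm_group_eq mult_group_simps)
    have "1 \<in> norm_group \<delta>"
    proof -
      have "1 = 1\<^sup>2 - \<delta> * 0\<^sup>2" by simp
      then show ?thesis unfolding norm_group_eq using one_neq_zero by blast
    qed
    then show "norm_group \<delta> \<noteq> {}" by auto
    fix n assume "n \<in> norm_group \<delta>"
    then obtain x y where n: "n \<noteq> 0" "n = x\<^sup>2 - \<delta> * y\<^sup>2"
      by (auto simp: norm_group_eq)
    have "inv\<^bsub>mult_group_of_field\<^esub> n = inverse n"
      by (rule inv_equality) (use n(1) in \<open>auto simp: mult_group_simps\<close>)
    moreover have "inverse n = (x / n)\<^sup>2 - \<delta> * (y / n)\<^sup>2"
    proof -
      have "(x / n)\<^sup>2 - \<delta> * (y / n)\<^sup>2 = (x\<^sup>2 - \<delta> * y\<^sup>2) / n\<^sup>2"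
        by (simp add: power_divide diff_divide_distrib)
      also have "\<dots> = inverse n"
        unfolding n(2)[symmetric] using n(1) by (simp add: power2_eq_square field_simps)
      finally show ?thesis by simp
    qed
    ultimately show "inv\<^bsub>mult_group_of_field\<^esub> n \<in> norm_group \<delta>"
      using n(1) by (auto simp: norm_group_eq)
  next
    fix m n assume "m \<in> norm_group \<delta>" "n \<in> norm_group \<delta>"
    then obtain x y u v
      where mn: "m = x\<^sup>2 - \<delta> * y\<^sup>2" "n = u\<^sup>2 - \<delta> * v\<^sup>2" and nz: "m * n \<noteq> 0"
      unfolding norm_group_eq by auto
    have "m * n = (x * u + \<delta> * y * v)\<^sup>2 - \<delta> * (x * v + y * u)\<^sup>2"
      by (simp only: quad_norm_mult mn)
    with nz show "m \<otimes>\<^bsub>mult_group_of_field\<^esub> n \<in> norm_group \<delta>"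
      unfolding norm_group_eq mult_group_simps by blast
  qed
  then show ?thesis by (rule subgroup_imp_normal)
qed

lemma norm_residue_eq_iff:
  fixes \<delta> :: "'a::field"
  assumes "s \<noteq> 0" "t \<noteq> 0"
  shows "norm_residue \<delta> s = norm_residue \<delta> t \<longleftrightarrow> s / t \<in> norm_group \<delta>"
proof -
  interpret comm_group "mult_group_of_field :: 'a monoid"
    by (rule comm_group_mult_group)
  interpret N: normal "norm_group \<delta>" mult_group_of_field
    by (rule norm_group_normal)
  have sub: "subgroup (norm_group \<delta>) mult_group_of_field" ..
  have "norm_residue \<delta> s = norm_residue \<delta> t \<longleftrightarrow> s \<in> norm_group \<delta> #>\<^bsub>mult_group_of_field\<^esub> t"
  proof -
    have s: "s \<in> carrier mult_group_of_field" and t: "t \<in> carrier mult_group_of_field"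
      using assms by (simp_all add: mult_group_simps)
    show ?thesis
      unfolding norm_residue_def
      using rcos_self[OF s sub] repr_independence[OF _ t sub, of s] by blast
  qed
  also have "\<dots> \<longleftrightarrow> s / t \<in> norm_group \<delta>"
    using assms by (force simp: r_coset_def mult_group_simps)
  finally show ?thesis .
qed


section \<open>The projective linear group\<close>

definition GL2 :: "('a::field ^ 2 ^ 2) monoid" where
  "GL2 = \<lparr>carrier = {M. invertible M}, mult = (**), one = mat 1\<rparr>"

definition scalars2 :: "('a::field ^ 2 ^ 2) set" where
  "scalars2 = {mat c | c. c \<noteq> 0}"

definition PGL2 :: "('a::field ^ 2 ^ 2) set monoid" where
  "PGL2 = GL2 Mod scalars2"

text \<open>
  Neither of the following two notions depends on the matrix \<open>M\<close> representing \<open>P\<close>,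
  as shown at the end of this theory.
\<close>

definition pgl2_det :: "'a::field \<Rightarrow> ('a ^ 2 ^ 2) set \<Rightarrow> 'a set" where
  "pgl2_det \<delta> P = the_elem ((\<lambda>M. norm_residue \<delta> (det M)) ` P)"

definition pgl2_conjugates :: "('a::field ^ 2 ^ 2) set \<Rightarrow> 'a ^ 2 ^ 2 \<Rightarrow> 'a ^ 2 ^ 2 \<Rightarrow> bool" where
  "pgl2_conjugates P a b \<longleftrightarrow> (\<exists>M\<in>P. M ** a ** matrix_inv M = b)"

lemma matrix_inv_mult:
  fixes M :: "'a::field ^ 2 ^ 2"
  assumes "invertible M"
  shows "M ** matrix_inv M = mat 1" "matrix_inv M ** M = mat 1"
  using assms someI_ex[of "\<lambda>A'. M ** A' = mat 1 \<and> A' ** M = mat 1"]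
  by (auto simp: invertible_def matrix_inv_def)

lemma conj_eq_iff:
  fixes M :: "'a::field ^ 2 ^ 2"
  assumes "invertible M"
  shows "M ** a ** matrix_inv M = b \<longleftrightarrow> M ** a = b ** M"
  by (metis assms matrix_inv_mult matrix_mul_assoc matrix_mul_rid)

lemma mat_mult_2:
  fixes M :: "'a::field ^ 2 ^ 2"
  shows "mat c ** M = (\<chi> i j. c * M $ i $ j)" "M ** mat c = (\<chi> i j. c * M $ i $ j)"
  by (simp_all add: matrix_matrix_mult_def mat_def vec_eq_iff forall_2 sum_2)

lemma det_mat_mult_2: "det (mat c ** M) = c\<^sup>2 * det M" for M :: "'a::field ^ 2 ^ 2"
  by (simp add: mat_mult_2 det_2 power2_eq_square algebra_simps)

lemma group_GL2: "group (GL2 :: ('a::field ^ 2 ^ 2) monoid)"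
proof (rule groupI)
  fix M :: "'a ^ 2 ^ 2"
  assume "M \<in> carrier GL2"
  then show "\<exists>N\<in>carrier GL2. N \<otimes>\<^bsub>GL2\<^esub> M = \<one>\<^bsub>GL2\<^esub>"
    by (auto simp: GL2_def invertible_def)
qed (auto simp: GL2_def matrix_mul_assoc invertible_mult invertible_det_nz det_mul)

lemma scalars2_normal: "scalars2 \<lhd> (GL2 :: ('a::field ^ 2 ^ 2) monoid)"
proof -
  interpret group "GL2 :: ('a ^ 2 ^ 2) monoid" by (rule group_GL2)
  have mm: "mat c ** mat d = (mat (c * d) :: 'a ^ 2 ^ 2)" for c d
    unfolding mat_mult_2 by (simp add: mat_def vec_eq_iff)
  have iv: "invertible (mat c :: 'a ^ 2 ^ 2)" if "c \<noteq> 0" for c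
    using that by (simp add: invertible_det_nz det_2 mat_def)
  have "subgroup scalars2 (GL2 :: ('a ^ 2 ^ 2) monoid)"
  proof (rule subgroupI)
    show "scalars2 \<subseteq> carrier (GL2 :: ('a ^ 2 ^ 2) monoid)"
      using iv by (auto simp: GL2_def scalars2_def)
    show "scalars2 \<noteq> ({} :: ('a ^ 2 ^ 2) set)"
      by (auto simp: scalars2_def intro: exI[of _ 1])
    fix M :: "'a ^ 2 ^ 2" assume "M \<in> scalars2"
    then obtain c where c: "c \<noteq> 0" "M = mat c" by (auto simp: scalars2_def)
    have "inv\<^bsub>GL2\<^esub> M = mat (inverse c)"
      by (rule inv_equality) (use c iv in \<open>auto simp: GL2_def mm\<close>)
    then show "inv\<^bsub>GL2\<^esub> M \<in> scalars2"
      using c(1) by (auto simp: scalars2_def)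
  next
    fix M N :: "'a ^ 2 ^ 2" assume "M \<in> scalars2" "N \<in> scalars2"
    then show "M \<otimes>\<^bsub>GL2\<^esub> N \<in> scalars2"
      by (force simp: scalars2_def GL2_def mm)
  qed
  then show ?thesis
    unfolding normal_def normal_axioms_def using is_group
    by (auto simp: r_coset_def l_coset_def scalars2_def GL2_def mat_mult_2)
qed

lemma carrier_PGL2: "carrier PGL2 = {scalars2 #>\<^bsub>GL2\<^esub> M | M. invertible M}"
  by (auto simp: PGL2_def carrier_FactGroup GL2_def)

lemma pgl2_class_eq: "scalars2 #>\<^bsub>GL2\<^esub> M = {mat c ** M | c. c \<noteq> 0}"
  by (auto simp: r_coset_def scalars2_def GL2_def)

lemma pgl2_det_class:
  fixes M :: "'a::field ^ 2 ^ 2"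
  assumes "invertible M"
  shows "pgl2_det \<delta> (scalars2 #>\<^bsub>GL2\<^esub> M) = norm_residue \<delta> (det M)"
proof -
  have "det M \<noteq> 0" using assms by (simp add: invertible_det_nz)
  then have "norm_residue \<delta> (det (mat c ** M)) = norm_residue \<delta> (det M)" if "c \<noteq> 0" for c
  proof -
    have "c\<^sup>2 = c\<^sup>2 - \<delta> * 0\<^sup>2" by simp
    then have "c\<^sup>2 \<in> norm_group \<delta>"
      using that unfolding norm_group_eq by (metis (mono_tags, lifting) mem_Collect_eq power_not_zero)
    then show ?thesis
      using that \<open>det M \<noteq> 0\<close> by (simp add: det_mat_mult_2 norm_residue_eq_iff)
  qed
  then have "(\<lambda>M. norm_residue \<delta> (det M)) ` (scalars2 #>\<^bsub>GL2\<^esub> M) = {norm_residue \<delta> (det M)}"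
    unfolding pgl2_class_eq by (auto simp: image_iff intro!: exI[of _ M] exI[of _ 1])
  then show ?thesis by (simp add: pgl2_det_def)
qed

lemma pgl2_conjugates_class:
  fixes M :: "'a::field ^ 2 ^ 2"
  assumes "invertible M"
  shows "pgl2_conjugates (scalars2 #>\<^bsub>GL2\<^esub> M) a b \<longleftrightarrow> M ** a ** matrix_inv M = b"
proof -
  have "(mat c ** M) ** a ** matrix_inv (mat c ** M) = b \<longleftrightarrow> M ** a ** matrix_inv M = b"
    if "c \<noteq> 0" for c
  proof -
    have "invertible (mat c ** M)"
      using assms that by (simp add: invertible_det_nz det_mat_mult_2)
    then have "(mat c ** M) ** a ** matrix_inv (mat c ** M) = b \<longleftrightarrow> mat c ** M ** a = b ** (mat c ** M)"
      by (rule conj_eq_iff)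
    also have "\<dots> \<longleftrightarrow> mat c ** (M ** a) = mat c ** (b ** M)"
    proof -
      have "b ** (mat c ** M) = mat c ** (b ** M)"
        by (metis mat_mult_2 matrix_mul_assoc)
      then show ?thesis by (simp add: matrix_mul_assoc)
    qed
    also have "\<dots> \<longleftrightarrow> M ** a = b ** M"
      using that by (simp add: mat_mult_2 vec_eq_iff)
    also have "\<dots> \<longleftrightarrow> M ** a ** matrix_inv M = b"
      by (rule conj_eq_iff[OF assms, symmetric])
    finally show ?thesis .
  qed
  moreover have "\<exists>c::'a. c \<noteq> 0" by (rule exI[of _ 1]) simp
  ultimately show ?thesis
    unfolding pgl2_conjugates_def pgl2_class_eq by blast
qed

end

theory Submission
  imports Defs
begin

text \<open>
  The matrix \<open>a + b\<close> conjugates \<open>a\<close> to \<open>b\<close>: by Cayley--Hamilton \<open>a\<^sup>2 = b\<^sup>2 = \<delta>\<close>, hence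
  \<open>(a + b) a = \<delta> + b a = b (a + b)\<close>. With \<open>d = - \<delta>\<close> its determinant is
  \<open>\<langle>a + b, a + b\<rangle> = 2 (d + \<langle>a, b\<rangle>)\<close>, which is nonzero exactly when \<open>bir a b\<close> is finite; and
  since \<open>bir a b = 2 d / (d + \<langle>a, b\<rangle>)\<close>, the product \<open>det (a + b) * bir a b = - 4 \<delta>\<close> is
  the norm of \<open>2 \<surd>\<delta>\<close>. Hence \<open>det (a + b)\<close> and \<open>bir a b\<close> have the same class modulo norms.

  Any other conjugating matrix is \<open>(a + b) K\<close> with \<open>K\<close> in the centralizer of \<open>a\<close>
  (lemma \<open>conjugator_factor\<close>). That centralizer is a copy of \<open>K[\<surd>\<delta>]\<close>, embedded by
  \<open>x + y \<surd>\<delta> \<mapsto> x + y a\<close>, on which the determinant is the norm (lemma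
  \<open>det_centralizer_sl2\<close>); so the choice of the conjugating matrix changes the determinant by a norm only.
\<close>

lemma sl2_entry_22: "a \<in> sl2 \<Longrightarrow> a $ 2 $ 2 = - a $ 1 $ 1"
  by (simp add: sl2_def trace_def sum_2 eq_neg_iff_add_eq_0 add.commute)

lemma two_neq_zero_of_CHAR:
  assumes "CHAR('a::field) \<noteq> 2"
  shows "(2 :: 'a) \<noteq> 0"
proof
  assume "(2 :: 'a) = 0"
  then have "of_nat 2 = (0 :: 'a)" by simp
  then have "CHAR('a) dvd 2" by (simp only: of_nat_eq_0_iff_char_dvd)
  then have "CHAR('a) = 1 \<or> CHAR('a) = 2"
    using two_is_prime_nat unfolding prime_nat_iff by blast
  with assms CHAR_not_1'[where 'a = 'a] show False by simp
qed

lemma matrix_mult_add_right_distrib: "(A + B) ** C = A ** C + B ** C"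
  for A B :: "'a::semiring_1 ^ 'n ^ 'm"
  by (simp add: matrix_matrix_mult_def vec_eq_iff distrib_right sum.distrib)

text \<open>This is the Cayley--Hamilton identity \<open>X\<^sup>2 = tr X * X - det X\<close>, polarized;
  the terms with the factor \<open>trace a\<close> vanish.\<close>

lemma sl2_anticommutator:
  assumes "a \<in> sl2"
  shows "M ** a + a ** M = mat (trace (M ** a)) + mat (trace M) ** a"
  using sl2_entry_22[OF assms]
  by (simp add: vec_eq_iff forall_2 matrix_matrix_mult_def mat_def trace_def sum_2 algebra_simps)

lemma sl2_square:
  assumes "a \<in> sl2"
  shows "a ** a = mat (- det a)"
  using sl2_entry_22[OF assms]
  by (simp add: vec_eq_iff forall_2 matrix_matrix_mult_def mat_def det_2 sum_2 algebra_simps)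

text \<open>If \<open>K\<close> commutes with \<open>a\<close>, the anticommutator is \<open>2 K a\<close>, and multiplying by \<open>a\<close>
  recovers \<open>K\<close> because \<open>a\<^sup>2\<close> is a nonzero scalar.\<close>

lemma centralizer_sl2:
  fixes a K :: "'a::field ^ 2 ^ 2"
  assumes two: "(2 :: 'a) \<noteq> 0" and \<delta>: "\<delta> \<noteq> 0"
    and a: "a \<in> sl2" "det a = - \<delta>" and comm: "K ** a = a ** K"
  shows "K = mat (trace K / 2) + mat (trace (K ** a) / (2 * \<delta>)) ** a"
proof -
  have "(K ** a + K ** a) ** a = (mat (trace (K ** a)) + mat (trace K) ** a) ** a"
    using sl2_anticommutator[OF a(1), of K] comm by simp
  then have "K ** (a ** a) + K ** (a ** a) = mat (trace (K ** a)) ** a + mat (trace K) ** (a ** a)"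
    by (simp only: matrix_mult_add_right_distrib matrix_mul_assoc)
  then have "K ** mat \<delta> + K ** mat \<delta> = mat (trace (K ** a)) ** a + mat (trace K) ** mat \<delta>"
    by (simp only: sl2_square[OF a(1)] a(2) minus_minus)
  then have "2 * \<delta> * K $ i $ j = trace (K ** a) * a $ i $ j + \<delta> * mat (trace K) $ i $ j" for i j
    unfolding mat_mult_2 vec_eq_iff vector_add_component vec_lambda_beta
    by (simp add: algebra_simps)
  then have "K $ i $ j = (trace (K ** a) * a $ i $ j + \<delta> * mat (trace K) $ i $ j) / (2 * \<delta>)" for i j
    using two \<delta> by (metis mult_eq_0_iff nonzero_mult_div_cancel_left)
  then show ?thesis
    using two \<delta> unfolding mat_mult_2 vec_eq_iff by (simp add: mat_def add_divide_distrib)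
qed

lemma det_centralizer_sl2:
  fixes a K :: "'a::field ^ 2 ^ 2"
  assumes "(2 :: 'a) \<noteq> 0" and "\<delta> \<noteq> 0"
    and a: "a \<in> sl2" "det a = - \<delta>" and "K ** a = a ** K"
  obtains x y where "det K = x\<^sup>2 - \<delta> * y\<^sup>2"
proof -
  obtain x y where K: "K = mat x + mat y ** a"
    using centralizer_sl2[OF assms] by blast
  have "det K = x\<^sup>2 + y\<^sup>2 * det a"
    using sl2_entry_22[OF a(1)]
    unfolding K mat_mult_2 by (simp add: det_2 mat_def power2_eq_square algebra_simps)
  then show thesis
    using that[of x y] by (simp add: a(2) algebra_simps)
qed

lemma conjugator_factor:
  fixes M N a b :: "'a::field ^ 2 ^ 2"
  assumes "invertible N" and N: "N ** a = b ** N" and M: "M ** a = b ** M"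
  obtains K where "M = N ** K" "K ** a = a ** K"
proof
  let ?K = "matrix_inv N ** M"
  note inv = matrix_inv_mult[OF assms(1)]
  show "M = N ** ?K" by (simp add: matrix_mul_assoc inv)
  have "matrix_inv N ** b = a ** matrix_inv N"
    by (metis N inv matrix_mul_assoc matrix_mul_lid matrix_mul_rid)
  then show "?K ** a = a ** ?K"
    by (metis M matrix_mul_assoc)
qed

lemma sum_conjugates_sl2:
  assumes "a \<in> sl2" "b \<in> sl2" "det a = det b"
  shows "(a + b) ** a = b ** (a + b)"
  using assms by (simp add: matrix_add_ldistrib matrix_mult_add_right_distrib sl2_square add.commute)

lemma det_sum_sl2:
  fixes a b :: "'a::field ^ 2 ^ 2"
  assumes "(2 :: 'a) \<noteq> 0" "a \<in> sl2" "b \<in> sl2"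
  shows "det (a + b) = det a + 2 * sl2_form a b + det b"
  using assms(1) sl2_entry_22[OF assms(2)] sl2_entry_22[OF assms(3)]
  by (simp add: sl2_form_def det_2 trace_def matrix_matrix_mult_def sum_2 algebra_simps)

theorem mainTheorem1:
  fixes \<delta> :: "'a::field" and a b :: "'a ^ 2 ^ 2"
  assumes "CHAR('a) \<noteq> 2"
    and "\<delta> \<noteq> 0"
    and "a \<in> sl2" and "b \<in> sl2"
    and "det a = - \<delta>" and "det b = - \<delta>"
    and "bir a b \<notin> {Finite 1, Infinity}"
  shows "\<exists>t. bir a b = Finite t \<and> norm_residue \<delta> t \<in> carrier (norm_quotient \<delta>) \<and>
           pgl2_det \<delta> ` {P \<in> carrier PGL2. pgl2_conjugates P a b} = {norm_residue \<delta> t}"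
proof -
  have two: "(2 :: 'a) \<noteq> 0"
    using assms(1) by (rule two_neq_zero_of_CHAR)
  define e where "e = sl2_form a b - \<delta>"
  have bir: "bir a b = (if sl2_form a b = \<delta> then Infinity else Finite (- 2 * \<delta> / e))"
    using bir_altdef[OF two assms(5)] assms(2) by (simp add: e_def)
  then have e: "e \<noteq> 0"
    using assms(7) by (auto simp: e_def)
  define t where "t = - 2 * \<delta> / e"
  have bir_t: "bir a b = Finite t"
    using bir e by (simp add: t_def e_def)
  have t: "t \<noteq> 0"
    using two assms(2) e by (simp add: t_def)
  have det_sum: "det (a + b) = 2 * e"
    using det_sum_sl2[OF two assms(3,4)] assms(5,6) by (simp add: e_def algebra_simps)
  have inv_sum: "invertible (a + b)"
    using two e by (simp add: invertible_det_nz det_sum)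
  have conj_sum: "(a + b) ** a = b ** (a + b)"
    by (rule sum_conjugates_sl2) (use assms(3-6) in auto)
  have residue: "norm_residue \<delta> (det M) = norm_residue \<delta> t"
    if M: "invertible M" "M ** a = b ** M" for M
  proof -
    obtain K where K: "M = (a + b) ** K" "K ** a = a ** K"
      using conjugator_factor[OF inv_sum conj_sum M(2)] .
    obtain x y where xy: "det K = x\<^sup>2 - \<delta> * y\<^sup>2"
      using det_centralizer_sl2[OF two assms(2,3,5) K(2)] .
    have nz: "det M \<noteq> 0"
      using M(1) by (simp add: invertible_det_nz)
    \<comment> \<open>\<open>det (a + b) / t\<close> is the norm of \<open>(2 / t) \<surd>\<delta>\<close>.\<close>
    have "2 * e / t = 0\<^sup>2 - \<delta> * (2 / t)\<^sup>2"
      using e two assms(2) by (simp add: t_def power2_eq_square field_simps)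
    moreover have "det M / t = (2 * e / t) * (x\<^sup>2 - \<delta> * y\<^sup>2)"
      unfolding K(1) det_mul det_sum xy by (rule times_divide_eq_left [symmetric])
    ultimately have "det M / t = (0\<^sup>2 - \<delta> * (2 / t)\<^sup>2) * (x\<^sup>2 - \<delta> * y\<^sup>2)"
      by (simp only:)
    then have "det M / t = (0 * x + \<delta> * (2 / t) * y)\<^sup>2 - \<delta> * (0 * y + 2 / t * x)\<^sup>2"
      by (simp only: quad_norm_mult)
    moreover have "det M / t \<noteq> 0"
      using nz t by simp
    ultimately have "det M / t \<in> norm_group \<delta>"
      unfolding norm_group_eq by blast
    then show ?thesis
      using nz t by (simp add: norm_residue_eq_iff)
  qed
  have dets: "pgl2_det \<delta> ` {P \<in> carrier PGL2. pgl2_conjugates P a b} = {norm_residue \<delta> t}"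
  proof (intro equalityI subsetI)
    fix c assume "c \<in> pgl2_det \<delta> ` {P \<in> carrier PGL2. pgl2_conjugates P a b}"
    then obtain M where "invertible M" "pgl2_conjugates (scalars2 #>\<^bsub>GL2\<^esub> M) a b"
      "c = pgl2_det \<delta> (scalars2 #>\<^bsub>GL2\<^esub> M)"
      by (auto simp: carrier_PGL2)
    then show "c \<in> {norm_residue \<delta> t}"
      by (simp add: pgl2_conjugates_class conj_eq_iff pgl2_det_class residue)
  next
    fix c assume "c \<in> {norm_residue \<delta> t}"
    then have "c = pgl2_det \<delta> (scalars2 #>\<^bsub>GL2\<^esub> (a + b))"
      using inv_sum conj_sum by (simp add: pgl2_det_class residue)
    moreover have "pgl2_conjugates (scalars2 #>\<^bsub>GL2\<^esub> (a + b)) a b"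
      unfolding pgl2_conjugates_class[OF inv_sum] conj_eq_iff[OF inv_sum] by (fact conj_sum)
    ultimately show "c \<in> pgl2_det \<delta> ` {P \<in> carrier PGL2. pgl2_conjugates P a b}"
      using inv_sum by (auto simp: carrier_PGL2)
  qed
  have "norm_residue \<delta> t \<in> carrier (norm_quotient \<delta>)"
    using t by (auto simp: norm_quotient_def norm_residue_def carrier_FactGroup mult_group_simps)
  with bir_t dets show ?thesis by blast
qed

end
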